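(* Let $n$ be a positive integer. (1) For partitions into distinct parts whose smallest part is odd, $$D^{+}_{\mathrm{odd}}(n)-D^{-}_{\mathrm{odd}}(n)=\begin{cases}0&\text{if } n \text{ is not a square},\\ 1&\text{if } n\text{ is an even square},\\ -1&\text{if } n\text{ is an odd square}.\end{cases}$$ (2) For partitions into distinct parts whose smallest part is even, $$D^{+}_{\mathrm{even}}(n)-D^{-}_{\mathrm{even}}(n)=\begin{cases}-1&\text{if } n\text{ is an even square and not a pentagonal number},\\ 1&\text{if } n\text{ is an odd square and not a pentagonal number},\\ 1&\text{if } n\text{ is an even index pentagonal number and not a square},\\ -1&\text{if } n\text{ is an odd index pentagonal number and not a square},\\ 0&\text{otherwise}.\end{cases}$$
   Context: A partition of $n$ is a finite non-increasing sequence of positive integers with sum $n$. $D^{+}_{\mathrm{even}}(n)$ (resp. $D^{+}_{\mathrm{odd}}(n)$) is the number of partitions of $n$ into an even number of distinct parts with smallest part even (resp. odd). $D^{-}_{\mathrm{even}}(n)$ (resp. $D^{-}_{\mathrm{odd}}(n)$) is the number of partitions of $n$ into an odd number of distinct parts with smallest part even (resp. odd). For any integer $k$ (positive, negative or zero), $\omega(k)=\frac{k(3k-1)}{2}$ is the index $k$ pentagonal number; a pentagonal number is an integer of the form $\omega(k)$ with $k\in\mathbb{Z}$, and it is called even index or odd index according to the parity of $k$. *)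

theory Defs
  imports Complex_Main "HOL-Computational_Algebra.Nth_Powers"
begin

definition is_partition :: "nat \<Rightarrow> nat list \<Rightarrow> bool" where
  "is_partition n xs \<longleftrightarrow> sorted_wrt (\<ge>) xs \<and> (\<forall>x\<in>set xs. x > 0) \<and> sum_list xs = n"

definition distinct_partitions :: "nat \<Rightarrow> nat list set" where
  "distinct_partitions n = {xs. is_partition n xs \<and> distinct xs}"

lemma finite_distinct_partitions: "finite (distinct_partitions n)"
proof (rule finite_subset)
  show "distinct_partitions n \<subseteq> {xs. set xs \<subseteq> {..n} \<and> distinct xs}"
    using member_le_sum_list by (auto simp: distinct_partitions_def is_partition_def)
  show "finite {xs. set xs \<subseteq> {..n} \<and> distinct xs}"
    using finite_subset_distinct[of "{..n}"] by (simp add: conj_commute)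
qed

(* Unspecified on the empty list, which is a partition of 0 only. *)
definition smallest_part :: "nat list \<Rightarrow> nat" where
  "smallest_part xs = Min (set xs)"

definition D_plus_even :: "nat \<Rightarrow> nat" where
  "D_plus_even n = card {xs \<in> distinct_partitions n. even (length xs) \<and> even (smallest_part xs)}"

definition D_plus_odd :: "nat \<Rightarrow> nat" where
  "D_plus_odd n = card {xs \<in> distinct_partitions n. even (length xs) \<and> odd (smallest_part xs)}"

definition D_minus_even :: "nat \<Rightarrow> nat" where
  "D_minus_even n = card {xs \<in> distinct_partitions n. odd (length xs) \<and> even (smallest_part xs)}"

definition D_minus_odd :: "nat \<Rightarrow> nat" where
  "D_minus_odd n = card {xs \<in> distinct_partitions n. odd (length xs) \<and> odd (smallest_part xs)}"

definition pentagonal :: "int \<Rightarrow> int" where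
  "pentagonal k = k * (3 * k - 1) div 2"

lemma two_pentagonal: "2 * pentagonal k = k * (3 * k - 1)"
  by (cases "even k") (auto simp: pentagonal_def)

definition is_pentagonal :: "nat \<Rightarrow> bool" where
  "is_pentagonal n \<longleftrightarrow> (\<exists>k. int n = pentagonal k)"

definition is_even_index_pentagonal :: "nat \<Rightarrow> bool" where
  "is_even_index_pentagonal n \<longleftrightarrow> (\<exists>k. even k \<and> int n = pentagonal k)"

definition is_odd_index_pentagonal :: "nat \<Rightarrow> bool" where
  "is_odd_index_pentagonal n \<longleftrightarrow> (\<exists>k. odd k \<and> int n = pentagonal k)"

(* The index is determined by the number, so even and odd index are mutually exclusive. *)
lemma inj_pentagonal: "inj pentagonal"
proof (rule injI)
  fix k l assume "pentagonal k = pentagonal l"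
  hence "k * (3 * k - 1) = l * (3 * l - 1)"
    by (metis two_pentagonal)
  hence "(k - l) * (3 * (k + l) - 1) = 0"
    by (simp add: algebra_simps)
  moreover have "3 * (k + l) - 1 \<noteq> 0"
    by presburger
  ultimately show "k = l"
    by simp
qed

end

theory Submission
  imports Defs "HOL-Computational_Algebra.Formal_Power_Series"
begin

text \<open>
  Count every partition of \<open>n\<close> into distinct parts with the sign \<open>(-1)\<close> to its length. Let \<open>E\<close> and \<open>O\<close>
  be the signed counts with even and with odd smallest part, so that part (1) evaluates \<open>O\<close> and
  part (2) evaluates \<open>E\<close>. Both follow from two theta series, one for \<open>E + O\<close> and one for \<open>E - O\<close>.

  The sum \<open>E + O\<close> is the coefficient of \<open>q^n\<close> in \<open>(q)_\<infinity> = (1 - q) (1 - q^2) \<dots>\<close>; by Euler's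
  pentagonal number theorem it is \<open>(-1)^k\<close> if \<open>n = \<omega>(k)\<close> and \<open>0\<close> otherwise. For \<open>E - O\<close> the sign is
  multiplied by \<open>(-1)^m\<close>, where \<open>m\<close> is the smallest part. Sorting the partitions by \<open>m\<close> gives minus
  the terms with \<open>m > 0\<close> of
  \<open>g(-q)\<close>, where \<open>g(z)\<close> is the sum of \<open>z^m (1 - q^(m+1)) (1 - q^(m+2)) \<dots>\<close> over all \<open>m \<ge> 0\<close>.
  The term \<open>m = 0\<close> is \<open>(q)_\<infinity>\<close>, so \<open>2 O = (E + O) - (E - O)\<close> is the coefficient of \<open>q^n\<close> in \<open>g(-q)\<close>.
  Euler's functional equation \<open>(1 - z) g(z) = g(z q)\<close>, iterated from \<open>z = -q\<close>, shows that
  \<open>(1 + q) (1 + q^2) \<dots> g(-q) = (q)_\<infinity>\<close>. By a theorem of Gauss, the quotient \<open>g(-q)\<close> is the theta series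
  \<open>1 - 2 q + 2 q^4 - 2 q^9 + \<dots>\<close>. Hence \<open>O\<close> is \<open>(-1)^s\<close> if \<open>n = s^2\<close> and \<open>0\<close> otherwise, and \<open>E\<close> is the
  pentagonal coefficient minus \<open>O\<close>.

  The theorems of Euler and Gauss are obtained from finite identities of Shanks,
  \<open>shanks_euler\<close> and \<open>shanks_gauss\<close>. Each evaluates a partial sum of the theta series exactly (the
  second one multiplied by \<open>(1 + q) \<dots> (1 + q^n)\<close>) as an alternating sum that starts with
  \<open>(1 - q) \<dots> (1 - q^n)\<close> and whose other terms are divisible by \<open>q^(n+1)\<close>. In this way limits become
  congruences modulo \<open>q^(n+1)\<close> in an arbitrary commutative ring, and power series enter only when
  the coefficient of \<open>q^n\<close> is extracted.

  In part (2) the two contributions must cancel whenever \<open>n\<close> is both a positive square and pentagonal.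
  This is the arithmetic fact \<open>pentagonal_square_parity\<close>.
\<close>

section \<open>Finite products and Euler's functional equation\<close>

text \<open>In terms of \<open>q\<close>-Pochhammer symbols, \<open>qfac q s n\<close> is the quotient \<open>(q)_n / (q)_s\<close>.\<close>

definition qfac :: "'a::comm_ring_1 \<Rightarrow> nat \<Rightarrow> nat \<Rightarrow> 'a" where
  "qfac q s n = (\<Prod>i\<in>{s<..n}. 1 - q ^ i)"

definition qplus :: "'a::comm_ring_1 \<Rightarrow> nat \<Rightarrow> 'a" where
  "qplus q n = (\<Prod>i\<in>{0<..n}. 1 + q ^ i)"

text \<open>Up to the factor \<open>(q)_n\<close>, this is a partial sum of Euler's \<open>q\<close>-exponential series, whose term
  of index \<open>m\<close> is \<open>z^m / (q)_m\<close>. Multiplying by \<open>(q)_n\<close> keeps it a polynomial in \<open>q\<close> and \<open>z\<close>.\<close>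

definition qexp :: "'a::comm_ring_1 \<Rightarrow> nat \<Rightarrow> 'a \<Rightarrow> 'a" where
  "qexp q n z = (\<Sum>m\<le>n. z ^ m * qfac q m n)"

lemma qfac_refl [simp]: "qfac q n n = 1"
  by (simp add: qfac_def)

lemma qfac_Suc_right: "s \<le> n \<Longrightarrow> qfac q s (Suc n) = qfac q s n * (1 - q ^ Suc n)"
  by (simp add: qfac_def atLeastSucAtMost_greaterThanAtMost [symmetric])

lemma qfac_Suc_left:
  assumes "s < n"
  shows "qfac q s n = (1 - q ^ Suc s) * qfac q (Suc s) n"
proof -
  have "{s<..n} = insert (Suc s) {Suc s<..n}" using assms by auto
  then show ?thesis by (simp add: qfac_def)
qed

lemma qplus_0 [simp]: "qplus q 0 = 1"
  by (simp add: qplus_def)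

lemma qplus_Suc: "qplus q (Suc n) = qplus q n * (1 + q ^ Suc n)"
  by (simp add: qplus_def atLeastSucAtMost_greaterThanAtMost [symmetric])

text \<open>The factor \<open>1 - q^m\<close> that appears in the difference of the values at \<open>z\<close> and \<open>z q\<close> lowers the index
  of \<open>qfac q m n\<close>, so that the sum reproduces itself, shifted by one term. The correction \<open>z^(n+1)\<close> comes
  from the truncation.\<close>

lemma qexp_step:
  fixes q :: "'a::comm_ring_1"
  shows "(1 - z) * qexp q n z = qexp q n (z * q) - z ^ Suc n"
proof -
  have "qexp q n z - qexp q n (z * q) = (\<Sum>m\<le>n. z ^ m * ((1 - q ^ m) * qfac q m n))"
    by (simp add: qexp_def sum_subtractf[symmetric] power_mult_distrib algebra_simps)
  also have "\<dots> = (\<Sum>m<n. z ^ Suc m * ((1 - q ^ Suc m) * qfac q (Suc m) n))"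
    by (simp add: sum.atMost_shift)
  also have "\<dots> = (\<Sum>m<n. z * (z ^ m * qfac q m n))"
    by (intro sum.cong) (simp_all add: qfac_Suc_left)
  also have "\<dots> = z * (qexp q n z - z ^ n)"
    by (simp add: qexp_def sum_distrib_left[symmetric] lessThan_Suc_atMost[symmetric])
  finally show ?thesis by (simp add: algebra_simps)
qed

text \<open>Starting at \<open>z = -q\<close>, each use of \<open>qexp_step\<close> moves one factor \<open>1 + q^k\<close> to the left and replaces
  \<open>z\<close> by \<open>z q\<close>. The truncation errors are multiples of \<open>q^(n+1)\<close>, and at \<open>z = -q^(n+1)\<close> all terms
  but the one with \<open>m = 0\<close> have become negligible.\<close>

lemma qplus_qexp_cong:
  fixes q :: "'a::comm_ring_1"
  shows "q ^ Suc n dvd qplus q n * qexp q n (- q) - qfac q 0 n"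
proof -
  have "q ^ Suc n dvd qplus q k * qexp q n (- q) - qexp q n (- (q ^ Suc k))" for k
  proof (induction k)
    case 0
    then show ?case by simp
  next
    case (Suc k)
    have "q ^ Suc n dvd (- (q ^ Suc k)) ^ Suc n"
      by (rule dvd_power_same) simp
    moreover have "qplus q (Suc k) * qexp q n (- q) - qexp q n (- (q ^ Suc (Suc k)))
      = (1 + q ^ Suc k) * (qplus q k * qexp q n (- q) - qexp q n (- (q ^ Suc k)))
        - (- (q ^ Suc k)) ^ Suc n"
      using qexp_step[of "- (q ^ Suc k)" q n]
      by (simp add: qplus_Suc algebra_simps)
    ultimately show ?case
      using Suc by (simp only: dvd_diff dvd_mult)
  qed
  moreover have "q ^ Suc n dvd qexp q n (- (q ^ Suc n)) - qfac q 0 n"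
  proof -
    have "qexp q n (- (q ^ Suc n)) - qfac q 0 n
        = (\<Sum>m<n. (- (q ^ Suc n)) ^ Suc m * qfac q (Suc m) n)"
      by (simp add: qexp_def sum.atMost_shift)
    also have "q ^ Suc n dvd \<dots>"
      by (intro dvd_sum dvd_mult2) simp
    finally show ?thesis .
  qed
  ultimately have "q ^ Suc n dvd (qplus q n * qexp q n (- q) - qexp q n (- (q ^ Suc n)))
      + (qexp q n (- (q ^ Suc n)) - qfac q 0 n)"
    by (rule dvd_add)
  then show ?thesis by simp
qed

section \<open>Finite identities for the theta series of Euler and Gauss\<close>

lemma alternating_telescope:
  fixes w :: "nat \<Rightarrow> 'a::comm_ring_1"
  shows "(\<Sum>s<n. (-1) ^ s * (w s + w (Suc s))) = w 0 - (-1) ^ n * w n"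
  by (induction n) (auto simp: algebra_simps)

text \<open>Increasing \<open>n\<close> by one changes the term of index \<open>s\<close> by \<open>- (w s + w (s + 1))\<close>, so the alternating sum of
  the changes telescopes to \<open>w (n + 1)\<close>, up to sign; together with the new last term this yields exactly the two
  new pentagonal exponents. The sums \<open>\<Sum>{..k}\<close> are the triangular numbers, so the exponents are
  \<open>k (3 k - 1) / 2\<close> and \<open>k (3 k + 1) / 2\<close>.\<close>

lemma shanks_euler:
  fixes q :: "'a::comm_ring_1"
  shows "(\<Sum>s\<le>n. (-1) ^ s * (qfac q s n * q ^ (s * n + \<Sum>{..s}))) =
         1 + (\<Sum>k=1..n. (-1) ^ k * (q ^ (k * (k - 1) + \<Sum>{..k}) + q ^ (k * k + \<Sum>{..k})))"
proof (induction n)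
  case 0
  then show ?case by simp
next
  case (Suc n)
  define v where "v n s = qfac q s n * q ^ (s * n + \<Sum>{..s})" for n s
  define w where "w s = (if s = 0 then 0 else qfac q (s - 1) n * q ^ (s * n + \<Sum>{..s}))" for s
  \<comment> \<open>For \<open>s > 0\<close>, \<open>w s\<close> is the part of \<open>v n s\<close> with the factor \<open>1 - q^s\<close>, which completes
    \<open>qfac q s n\<close> to \<open>qfac q (s - 1) n\<close>; for \<open>s = 0\<close> this factor vanishes.\<close>
  have step: "v (Suc n) s = v n s - (w s + w (Suc s))" if s: "s \<le> n" for s
  proof (cases s)
    case 0
    then show ?thesis
      by (simp add: v_def w_def qfac_Suc_right algebra_simps)
  next
    case (Suc r)
    then have left: "qfac q r n = (1 - q ^ s) * qfac q s n"
      using qfac_Suc_left[of r n q] s by simp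
    show ?thesis using s Suc
      by (simp add: v_def w_def qfac_Suc_right left power_add algebra_simps)
  qed
  have "(\<Sum>s\<le>Suc n. (-1) ^ s * v (Suc n) s)
      = (\<Sum>s\<le>n. (-1) ^ s * v n s) - (\<Sum>s<Suc n. (-1) ^ s * (w s + w (Suc s)))
        + (-1) ^ Suc n * v (Suc n) (Suc n)"
    by (simp add: step algebra_simps lessThan_Suc_atMost sum_subtractf del: power_Suc)
  also have "(\<Sum>s<Suc n. (-1) ^ s * (w s + w (Suc s))) = - ((-1) ^ Suc n * w (Suc n))"
    by (subst alternating_telescope) (simp add: w_def)
  finally show ?case
    using Suc by (simp add: v_def w_def algebra_simps)
qed

text \<open>The proof has the same shape as that of \<open>shanks_euler\<close>. The classical identity of rational functions
  is multiplied by \<open>qplus q n\<close>, and this is why the weight \<open>qplus q (s - 1)\<close> appears on the right: it is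
  what remains of \<open>qplus q s / (1 + q^s)\<close>.\<close>

lemma shanks_gauss:
  fixes q :: "'a::comm_ring_1"
  shows "qplus q n * (1 + 2 * (\<Sum>j=1..n. (-1) ^ j * q ^ (j * j))) =
         qfac q 0 n + 2 * (\<Sum>s=1..n. (-1) ^ s * (q ^ (s * Suc n) * qfac q s n * qplus q (s - 1)))"
proof (induction n)
  case 0
  then show ?case by simp
next
  case (Suc n)
  define t where "t n s = q ^ (s * Suc n) * qfac q s n * qplus q (s - 1)" for n s
  define T where "T n = qfac q 0 n + 2 * (\<Sum>s=1..n. (-1) ^ s * t n s)" for n
  define u where "u s = q ^ (Suc s * Suc n) * qfac q s n * qplus q s" for s
  \<comment> \<open>This is where \<open>q^s (1 - q^(n+1)) - (1 + q^(n+1)) = - ((1 - q^s) + q^(n+1) (1 + q^s))\<close> enters,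
    with \<open>s = r + 1\<close>: the factors \<open>1 - q^s\<close> and \<open>1 + q^s\<close> are absorbed by \<open>qfac\<close> and \<open>qplus\<close>.\<close>
  have step: "t (Suc n) (Suc r) = (1 + q ^ Suc n) * t n (Suc r) - (u r + u (Suc r))"
    if r: "r < n" for r
  proof -
    note left = qfac_Suc_left[OF r, of q]
    show ?thesis using r
      by (simp add: t_def u_def left qfac_Suc_right qplus_Suc power_add algebra_simps)
  qed
  have shift: "(\<Sum>s=1..m. f s) = (\<Sum>r<m. f (Suc r))" for m and f :: "nat \<Rightarrow> 'a"
    by (simp add: sum.atLeast1_atMost_eq)
  have "(\<Sum>s=1..Suc n. (-1) ^ s * t (Suc n) s)
      = (\<Sum>r<n. (-1) ^ Suc r * t (Suc n) (Suc r)) + (-1) ^ Suc n * t (Suc n) (Suc n)"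
    unfolding shift by simp
  also have "(\<Sum>r<n. (-1) ^ Suc r * t (Suc n) (Suc r))
      = (\<Sum>r<n. (1 + q ^ Suc n) * ((-1) ^ Suc r * t n (Suc r)) + (-1) ^ r * (u r + u (Suc r)))"
    by (intro sum.cong) (simp_all add: step algebra_simps)
  also have "\<dots> = (1 + q ^ Suc n) * (\<Sum>s=1..n. (-1) ^ s * t n s) + (u 0 - (-1) ^ n * u n)"
    unfolding shift by (simp only: sum.distrib sum_distrib_left alternating_telescope)
  finally have t_sum: "(\<Sum>s=1..Suc n. (-1) ^ s * t (Suc n) s)
      = (1 + q ^ Suc n) * (\<Sum>s=1..n. (-1) ^ s * t n s) + (u 0 - (-1) ^ n * u n)
        + (-1) ^ Suc n * t (Suc n) (Suc n)" .
  have "T (Suc n) = (1 + q ^ Suc n) * T n + 2 * (-1) ^ Suc n * (u n + t (Suc n) (Suc n))"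
    unfolding T_def t_sum by (simp add: u_def qfac_Suc_right algebra_simps)
  moreover have "u n + t (Suc n) (Suc n) = q ^ (Suc n * Suc n) * qplus q (Suc n)"
    by (simp add: t_def u_def qplus_Suc power_add algebra_simps)
  moreover have "qplus q n * (1 + 2 * (\<Sum>j=1..n. (-1) ^ j * q ^ (j * j))) = T n"
    using Suc by (simp only: T_def t_def)
  moreover have "qplus q (Suc n) * (1 + 2 * (\<Sum>j=1..Suc n. (-1) ^ j * q ^ (j * j)))
      = (1 + q ^ Suc n) * (qplus q n * (1 + 2 * (\<Sum>j=1..n. (-1) ^ j * q ^ (j * j))))
        + 2 * (-1) ^ Suc n * (q ^ (Suc n * Suc n) * qplus q (Suc n))"
    by (simp add: qplus_Suc algebra_simps)
  ultimately show ?case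
    by (simp only: T_def t_def)
qed

text \<open>Both \<open>qexp q n (- q)\<close> and the theta series have the product \<open>qfac q 0 n\<close> with \<open>qplus q n\<close>, up to
  multiples of \<open>q^(n+1)\<close>.\<close>

lemma qexp_theta_cong:
  fixes q :: "'a::comm_ring_1"
  shows "q ^ Suc n dvd qplus q n * (qexp q n (- q) - (1 + 2 * (\<Sum>j=1..n. (-1) ^ j * q ^ (j * j))))"
proof -
  let ?R = "2 * (\<Sum>s=1..n. (-1) ^ s * (q ^ (s * Suc n) * qfac q s n * qplus q (s - 1)))"
  have "q ^ Suc n dvd ?R"
  proof (rule dvd_mult, rule dvd_sum, rule dvd_mult, rule dvd_mult2, rule dvd_mult2)
    fix s assume "s \<in> {1..n}"
    then show "q ^ Suc n dvd q ^ (s * Suc n)"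
      by (intro le_imp_power_dvd) (metis One_nat_def atLeastAtMost_iff mult_le_mono1 nat_mult_1)
  qed
  with qplus_qexp_cong[of q n]
  have "q ^ Suc n dvd (qplus q n * qexp q n (- q) - qfac q 0 n) - ?R" by (rule dvd_diff)
  then show ?thesis
    unfolding right_diff_distrib shanks_gauss by (simp add: algebra_simps)
qed

lemma euler_cong:
  fixes q :: "'a::comm_ring_1"
  shows "q ^ Suc n dvd qfac q 0 n -
    (1 + (\<Sum>k=1..n. (-1) ^ k * (q ^ (k * (k - 1) + \<Sum>{..k}) + q ^ (k * k + \<Sum>{..k}))))"
proof -
  have "q ^ Suc n dvd q ^ (Suc r * n + \<Sum>{..Suc r})" for r
    by (intro le_imp_power_dvd) simp
  then have "q ^ Suc n dvd (\<Sum>r<n. (-1) ^ Suc r * (qfac q (Suc r) n * q ^ (Suc r * n + \<Sum>{..Suc r})))"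
    by (intro dvd_sum dvd_mult)
  then show ?thesis
    unfolding shanks_euler[symmetric] by (simp add: sum.atMost_shift dvd_minus_iff)
qed

section \<open>Generating functions of signed subsets\<close>

lemma sum_Pow_qfac:
  fixes q :: "'a::comm_ring_1"
  shows "(\<Sum>S\<in>Pow {m<..n}. (-1) ^ card S * q ^ \<Sum>S) = qfac q m n"
  by (simp add: qfac_def prod_diff_conv_sum power_sum)

text \<open>A nonempty set with minimum \<open>m\<close> is \<open>{m}\<close> together with an arbitrary subset of \<open>{m<..n}\<close>, and the
  signed sum over the latter is \<open>qfac q m n\<close>.\<close>

lemma sum_Pow_Min:
  fixes q :: "'a::comm_ring_1"
  shows "(\<Sum>S\<in>Pow {0<..n} - {{}}. w (Min S) * (-1) ^ card S * q ^ \<Sum>S) =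
         - (\<Sum>m=1..n. w m * q ^ m * qfac q m n)"
proof -
  define f where "f S = w (Min S) * (-1) ^ card S * q ^ \<Sum>S" for S
  have ins: "f (insert m S) = - (w m * q ^ m * ((-1) ^ card S * q ^ \<Sum>S))"
    if "S \<in> Pow {m<..n}" for m S
  proof -
    have fin: "finite S" "m \<notin> S" using that by (auto intro: finite_subset)
    moreover have "Min (insert m S) = m"
      using that fin by (intro Min_eqI) auto
    ultimately show ?thesis by (simp add: f_def power_add)
  qed
  have "(\<Sum>S\<in>Pow {0<..n} - {{}}. f S)
      = (\<Sum>(m, S)\<in>(SIGMA m:{1..n}. Pow {m<..n}). f (insert m S))"
  proof (rule sum.reindex_bij_witness[of _ "\<lambda>(m, S). insert m S" "\<lambda>S. (Min S, S - {Min S})"])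
    fix S assume S: "S \<in> Pow {0<..n} - {{}}"
    then have fin: "finite S" and Min: "Min S \<in> S"
      by (auto intro: finite_subset Min_in)
    then show "(case (Min S, S - {Min S}) of (m, S) \<Rightarrow> insert m S) = S"
      and "(case (Min S, S - {Min S}) of (m, S) \<Rightarrow> f (insert m S)) = f S"
      by (auto simp: insert_absorb)
    show "(Min S, S - {Min S}) \<in> (SIGMA m:{1..n}. Pow {m<..n})"
    proof -
      have "x \<in> {Min S<..n}" if "x \<in> S - {Min S}" for x
        using that S Min_le[OF fin, of x] by auto
      then have "S - {Min S} \<in> Pow {Min S<..n}" by blast
      moreover have "Min S \<in> {1..n}" using S Min by auto
      ultimately show ?thesis by blast
    qed
  next
    fix x assume "x \<in> (SIGMA m:{1..n}. Pow {m<..n})"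
    then obtain m S where x: "x = (m, S)" "m \<in> {1..n}" "S \<subseteq> {m<..n}" by auto
    then have "Min (insert m S) = m"
      by (intro Min_eqI) (auto intro: finite_subset)
    with x show "(Min (case x of (m, S) \<Rightarrow> insert m S),
        (case x of (m, S) \<Rightarrow> insert m S) - {Min (case x of (m, S) \<Rightarrow> insert m S)}) = x"
      by auto
    show "(case x of (m, S) \<Rightarrow> insert m S) \<in> Pow {0<..n} - {{}}"
      using x by auto
  qed
  also have "\<dots> = (\<Sum>m=1..n. \<Sum>S\<in>Pow {m<..n}. f (insert m S))"
    by (rule sum.Sigma [symmetric]) auto
  also have "\<dots> = - (\<Sum>m=1..n. w m * q ^ m * qfac q m n)"
    by (simp only: ins sum_negf sum_distrib_left[symmetric] sum_Pow_qfac cong: sum.cong)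
  finally show ?thesis by (simp add: f_def)
qed

section \<open>Extracting coefficients\<close>

lemma fps_nth_eq_if_dvd_diff:
  fixes f g :: "'a::comm_ring_1 fps"
  assumes "fps_X ^ Suc n dvd f - g"
  shows "fps_nth f n = fps_nth g n"
proof -
  obtain h where "f - g = fps_X ^ Suc n * h" using assms by (auto elim: dvdE)
  then have "fps_nth (f - g) n = 0" by (simp only: fps_X_power_mult_nth) simp
  then show ?thesis by simp
qed

lemma fps_nth_neg_one_power_mult:
  fixes f :: "'a::comm_ring_1 fps"
  shows "fps_nth ((-1) ^ k * f) n = (-1) ^ k * fps_nth f n"
  by (cases "even k") auto

text \<open>A power series with constant term \<open>1\<close> is invertible over every commutative ring; this allows
  \<open>qplus\<close> to be cancelled from a congruence with integer coefficients.\<close>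

lemma dvd_cancel_fps_unit:
  fixes f g d :: "'a::comm_ring_1 fps"
  assumes "fps_nth f 0 = 1" "d dvd f * g"
  shows "d dvd g"
proof -
  have "f * fps_right_inverse f 1 = 1"
    using assms(1) by (intro fps_right_inverse) simp
  then have "g = (f * g) * fps_right_inverse f 1"
    by (metis mult.assoc mult.commute mult_1)
  then show ?thesis using assms(2) by (metis dvd_mult2)
qed

lemma fps_nth_qplus_0: "fps_nth (qplus fps_X n) 0 = 1"
  by (induction n) (auto simp: qplus_Suc)

section \<open>Partitions into distinct parts as sets\<close>

lemma sum_distinct_partitions:
  "(\<Sum>xs\<in>distinct_partitions n. f (set xs)) = (\<Sum>S\<in>{S\<in>Pow {0<..n}. \<Sum>S = n}. f S)"
proof (rule sum.reindex_bij_witness[of _ "\<lambda>S. rev (sorted_list_of_set S)" set])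
  fix xs assume "xs \<in> distinct_partitions n"
  then have xs: "sorted_wrt (\<ge>) xs" "\<forall>x\<in>set xs. x > 0" "sum_list xs = n" "distinct xs"
    by (auto simp: distinct_partitions_def is_partition_def)
  then have "sorted (rev xs)" by (simp add: sorted_wrt_rev)
  then show "rev (sorted_list_of_set (set xs)) = xs"
    using xs(4) sorted_list_of_set.idem_if_sorted_distinct[of "rev xs"] by simp
  show "set xs \<in> {S\<in>Pow {0<..n}. \<Sum>S = n}"
    using xs member_le_sum_list[of _ xs] by (auto simp: distinct_sum_list_conv_Sum)
next
  fix S assume S: "S \<in> {S\<in>Pow {0<..n}. \<Sum>S = n}"
  then have "finite S" by (auto intro: finite_subset)
  then show "set (rev (sorted_list_of_set S)) = S" by simp
  show "rev (sorted_list_of_set S) \<in> distinct_partitions n"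
    using S \<open>finite S\<close> strict_sorted_imp_sorted
    by (auto simp: distinct_partitions_def is_partition_def sorted_wrt_rev
        distinct_sum_list_conv_Sum)
qed auto

lemma card_even_minus_card_odd:
  assumes "finite A"
  shows "int (card {x\<in>A. even (l x) \<and> P x}) - int (card {x\<in>A. odd (l x) \<and> P x})
       = (\<Sum>x\<in>{x\<in>A. P x}. (-1) ^ l x)"
proof -
  let ?E = "{x\<in>A. even (l x) \<and> P x}" and ?O = "{x\<in>A. odd (l x) \<and> P x}"
  have "{x\<in>A. P x} = ?E \<union> ?O" by auto
  then have "(\<Sum>x\<in>{x\<in>A. P x}. (-1) ^ l x) = (\<Sum>x\<in>?E. (-1) ^ l x) + (\<Sum>x\<in>?O. (-1) ^ l x :: int)"
    using assms by (simp only:) (subst sum.union_disjoint, auto)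
  then show ?thesis by simp
qed

lemma fps_nth_signed_subset_sum:
  fixes c :: "nat set \<Rightarrow> nat"
  assumes "finite F"
  shows "fps_nth (\<Sum>S\<in>F. (-1) ^ c S * fps_X ^ \<Sum>S :: int fps) n = (\<Sum>S\<in>{S\<in>F. \<Sum>S = n}. (-1) ^ c S)"
  using assms
  by (auto simp: fps_sum_nth fps_nth_neg_one_power_mult intro!: sum.mono_neutral_cong_right
      split: if_splits)

lemma sum_sign_distinct_partitions:
  "(\<Sum>xs\<in>distinct_partitions n. (-1) ^ length xs) = fps_nth (qfac fps_X 0 n :: int fps) n"
proof -
  have "(\<Sum>xs\<in>distinct_partitions n. (-1) ^ length xs)
      = (\<Sum>xs\<in>distinct_partitions n. (-1) ^ card (set xs) :: int)"
    by (intro sum.cong) (auto simp: distinct_partitions_def distinct_card)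
  also have "\<dots> = fps_nth (\<Sum>S\<in>Pow {0<..n}. (-1) ^ card S * fps_X ^ \<Sum>S :: int fps) n"
    by (subst fps_nth_signed_subset_sum) (simp_all add: sum_distinct_partitions[of "\<lambda>S. (-1) ^ card S"])
  finally show ?thesis by (simp only: sum_Pow_qfac)
qed

text \<open>The difference on the right removes from \<open>- qexp\<close> its term with \<open>m = 0\<close>, which belongs to no nonempty
  set; the empty partition is excluded by \<open>n > 0\<close>.\<close>

lemma sum_sign_smallest_distinct_partitions:
  assumes "n > 0"
  shows "(\<Sum>xs\<in>distinct_partitions n. (-1) ^ (smallest_part xs + length xs)) =
         fps_nth (qfac fps_X 0 n - qexp fps_X n (- fps_X) :: int fps) n"
proof -
  have "(\<Sum>xs\<in>distinct_partitions n. (-1) ^ (smallest_part xs + length xs))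
      = (\<Sum>xs\<in>distinct_partitions n. (-1) ^ (Min (set xs) + card (set xs)) :: int)"
    by (intro sum.cong) (auto simp: distinct_partitions_def distinct_card smallest_part_def)
  also have "\<dots> = (\<Sum>S\<in>{S\<in>Pow {0<..n}. \<Sum>S = n}. (-1) ^ (Min S + card S))"
    by (rule sum_distinct_partitions)
  also have "{S\<in>Pow {0<..n}. \<Sum>S = n} = {S\<in>Pow {0<..n} - {{}}. \<Sum>S = n}"
    using assms by auto
  also have "(\<Sum>S\<in>\<dots>. (-1) ^ (Min S + card S))
      = fps_nth (\<Sum>S\<in>Pow {0<..n} - {{}}. (-1) ^ (Min S + card S) * fps_X ^ \<Sum>S :: int fps) n"
    by (subst fps_nth_signed_subset_sum) auto
  also have "(\<Sum>S\<in>Pow {0<..n} - {{}}. (-1) ^ (Min S + card S) * fps_X ^ \<Sum>S :: int fps)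
      = - (\<Sum>m=1..n. (-1) ^ m * fps_X ^ m * qfac fps_X m n)"
    unfolding power_add by (rule sum_Pow_Min)
  also have "\<dots> = qfac fps_X 0 n - qexp fps_X n (- fps_X)"
    by (simp add: qexp_def sum.atMost_shift sum.atLeast1_atMost_eq power_minus[of fps_X])
  finally show ?thesis .
qed

section \<open>The coefficients of the two theta series\<close>

text \<open>If \<open>n = s^2\<close>, then \<open>s\<close> and \<open>n\<close> have the same parity, so the sign \<open>(-1)^s\<close> of the theta series is
  \<open>(-1)^n\<close>.\<close>

lemma fps_nth_qexp_square:
  assumes "n > 0"
  shows "fps_nth (qexp fps_X n (- fps_X) :: int fps) n = (if is_square n then 2 * (-1) ^ n else 0)"
proof -
  let ?theta = "1 + 2 * (\<Sum>j=1..n. (-1) ^ j * fps_X ^ (j * j)) :: int fps"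
  have double: "fps_nth (2 * f) n = 2 * fps_nth f n" for f :: "int fps"
    by (simp only: mult_2 fps_add_nth)
  have "fps_nth (qexp fps_X n (- fps_X)) n = fps_nth ?theta n"
    by (rule fps_nth_eq_if_dvd_diff, rule dvd_cancel_fps_unit[OF fps_nth_qplus_0 qexp_theta_cong])
  also have "\<dots> = 2 * (\<Sum>j=1..n. (-1) ^ j * (if n = j * j then 1 else 0))"
    using assms by (simp add: double fps_sum_nth fps_nth_neg_one_power_mult)
  also have "(\<Sum>j=1..n. (-1) ^ j * (if n = j * j then 1 else 0)) = (if is_square n then (-1) ^ n else 0 :: int)"
  proof (cases "is_square n")
    case True
    then obtain s where s: "n = s ^ 2" by (auto elim: is_nth_powerE)
    then have *: "n = j * j \<longleftrightarrow> j = s" for j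
      by (simp add: power2_eq_square[symmetric]) (metis power2_eq_iff_nonneg zero_le)
    have "s \<in> {1..n}"
      using s assms by (cases s) (auto simp: power2_eq_square)
    then show ?thesis
      using True s unfolding * by (simp add: if_distrib[of "(*) _"] sum.delta minus_one_power_iff cong: if_cong)
  next
    case False
    then have "n \<noteq> j * j" for j
      by (metis is_nth_powerI power2_eq_square)
    then show ?thesis using False by simp
  qed
  finally show ?thesis by simp
qed

lemma fps_nth_qfac_pentagonal:
  assumes "n > 0"
  shows "int n = pentagonal k \<Longrightarrow> fps_nth (qfac fps_X 0 n :: int fps) n = (if even k then 1 else -1)"
    and "\<not> is_pentagonal n \<Longrightarrow> fps_nth (qfac fps_X 0 n :: int fps) n = 0"
proof -
  have tri: "2 * int (m + \<Sum>{..k}) = 2 * int m + int (k * Suc k)" for m k :: nat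
    by (induction k) auto
  have pos: "int (k * (k - 1) + \<Sum>{..k}) = pentagonal (int k)" if "k \<ge> 1" for k
  proof -
    have "2 * int (k * (k - 1) + \<Sum>{..k}) = 2 * int (k * (k - 1)) + int (k * Suc k)"
      by (rule tri)
    also have "\<dots> = 2 * pentagonal (int k)"
      unfolding two_pentagonal using that by (simp add: of_nat_diff algebra_simps)
    finally show ?thesis by simp
  qed
  have neg: "int (k * k + \<Sum>{..k}) = pentagonal (- int k)" for k
  proof -
    have "2 * int (k * k + \<Sum>{..k}) = 2 * int (k * k) + int (k * Suc k)"
      by (rule tri)
    also have "\<dots> = 2 * pentagonal (- int k)"
      unfolding two_pentagonal by (simp add: algebra_simps)
    finally show ?thesis by simp
  qed
  have eq: "fps_nth (qfac fps_X 0 n :: int fps) n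
      = (\<Sum>k=1..n. (-1) ^ k * ((if int n = pentagonal (int k) then 1 else 0)
                             + (if int n = pentagonal (- int k) then 1 else 0)))"
  proof -
    have "fps_nth (qfac fps_X 0 n :: int fps) n
      = fps_nth (1 + (\<Sum>k=1..n. (-1) ^ k * (fps_X ^ (k * (k - 1) + \<Sum>{..k}) + fps_X ^ (k * k + \<Sum>{..k})))) n"
      by (rule fps_nth_eq_if_dvd_diff[OF euler_cong])
    also have "\<dots> = (\<Sum>k=1..n. (-1) ^ k * ((if n = k * (k - 1) + \<Sum>{..k} then 1 else 0)
                             + (if n = k * k + \<Sum>{..k} then 1 else 0)))"
      using assms by (simp add: fps_sum_nth fps_nth_neg_one_power_mult)
    also have "\<dots> = (\<Sum>k=1..n. (-1) ^ k * ((if int n = pentagonal (int k) then 1 else 0)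
                             + (if int n = pentagonal (- int k) then 1 else 0)))"
      by (intro sum.cong refl) (simp only: pos[symmetric] neg[symmetric] of_nat_eq_iff atLeastAtMost_iff)
    finally show ?thesis .
  qed
  show "fps_nth (qfac fps_X 0 n :: int fps) n = 0" if "\<not> is_pentagonal n"
    using that unfolding eq is_pentagonal_def by simp
  show "fps_nth (qfac fps_X 0 n :: int fps) n = (if even k then 1 else -1)" if k: "int n = pentagonal k"
  proof -
    have *: "int n = pentagonal l \<longleftrightarrow> l = k" for l
      using k inj_pentagonal by (auto dest: injD)
    have "k \<noteq> 0" using k assms by (auto simp: pentagonal_def)
    \<comment> \<open>A pentagonal number is at least as large as the absolute value of its index, so the index
      lies in the range of the truncated sum.\<close>
    have "2 * \<bar>k\<bar> \<le> 2 * int n"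
    proof -
      have "\<bar>k\<bar> * 2 \<le> \<bar>k\<bar> * \<bar>3 * k - 1\<bar>"
        using \<open>k \<noteq> 0\<close> by (intro mult_left_mono) auto
      also have "\<dots> = \<bar>2 * int n\<bar>" unfolding k two_pentagonal by (simp add: abs_mult)
      finally show ?thesis by simp
    qed
    then have mem: "nat \<bar>k\<bar> \<in> {1..n}" using \<open>k \<noteq> 0\<close> by auto
    have "(\<Sum>j=1..n. (-1) ^ j * ((if int j = k then 1 else 0) + (if - int j = k then 1 else 0)))
        = (\<Sum>j=1..n. if j = nat \<bar>k\<bar> then (-1) ^ j else 0 :: int)"
      by (intro sum.cong) auto
    also have "\<dots> = (-1) ^ nat \<bar>k\<bar>" using mem by (simp add: sum.delta)
    finally show ?thesis unfolding eq * by (simp add: minus_one_power_iff even_nat_iff)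
  qed
qed

section \<open>Numbers that are both square and pentagonal\<close>

lemma square_mod:
  fixes m :: nat
  assumes "is_square m"
  shows "m mod 4 = 0 \<or> m mod 4 = 1" and "m mod 3 = 0 \<or> m mod 3 = 1"
proof -
  obtain s where s: "m = s ^ 2" using assms by (auto elim: is_nth_powerE)
  have "s mod 4 \<in> {0, 1, 2, 3}" by auto
  moreover have "m mod 4 = (s mod 4) ^ 2 mod 4" unfolding s by (simp add: power_mod)
  ultimately show "m mod 4 = 0 \<or> m mod 4 = 1" by auto
  have "s mod 3 \<in> {0, 1, 2}" by auto
  moreover have "m mod 3 = (s mod 3) ^ 2 mod 3" unfolding s by (simp add: power_mod)
  ultimately show "m mod 3 = 0 \<or> m mod 3 = 1" by auto
qed

text \<open>The number \<open>k (3 k - 1) / 2\<close> is a product of two coprime factors: \<open>k / 2\<close> and \<open>3 k - 1\<close> if \<open>k\<close> is even,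
  \<open>k\<close> and \<open>(3 k - 1) / 2\<close> if \<open>k\<close> is odd. If the product is a positive square, both factors are squares up to
  a common sign. In each of the four cases given by the parity and the sign of \<open>k\<close>, the residues of
  squares modulo \<open>3\<close> and \<open>4\<close> either force the claimed parity of \<open>n\<close> or lead to a contradiction.\<close>

lemma pentagonal_square_parity:
  assumes "n > 0" "int n = pentagonal k" "is_square n"
  shows "even k \<longleftrightarrow> even n"
proof -
  have squares: "is_square a \<and> is_square b" if "n = a * b" "coprime a b" for a b
    using that assms(3) by (simp add: is_nth_power_mult_coprime_nat_iff)
  have eq: "2 * int n = k * (3 * k - 1)"
    using assms(2) two_pentagonal by simp
  have "even n" if "even k"
  proof -
    obtain j where "k = 2 * j" using \<open>even k\<close> by blast
    with eq have j: "int n = j * (6 * j - 1)" by simp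
    show ?thesis
    proof (cases j rule: int_cases2)
      case (nonneg a)
      with j assms(1) obtain b where a: "a = Suc b" by (cases a) auto
      have "int n = int ((b + 1) * (6 * b + 5))"
        unfolding j nonneg a by (simp add: algebra_simps)
      then have "n = (b + 1) * (6 * b + 5)" by (simp only: of_nat_eq_iff)
      moreover have "coprime (b + 1) (6 * b + 5)"
      proof (rule coprimeI)
        fix c assume "c dvd b + 1" "c dvd 6 * b + 5"
        then have "c dvd 6 * (b + 1) - (6 * b + 5)" by (intro dvd_diff_nat dvd_mult)
        then show "is_unit c" by simp
      qed
      ultimately have "is_square (6 * b + 5)" using squares by blast
      from square_mod(2)[OF this] have False by presburger
      then show ?thesis ..
    next
      case (nonpos a)
      have "int n = int (a * (6 * a + 1))"
        unfolding j nonpos by (simp add: algebra_simps)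
      then have n: "n = a * (6 * a + 1)" by (simp only: of_nat_eq_iff)
      moreover have "coprime a (6 * a + 1)"
      proof (rule coprimeI)
        fix c assume "c dvd a" "c dvd 6 * a + 1"
        then have "c dvd 6 * a + 1 - 6 * a" by (intro dvd_diff_nat dvd_mult)
        then show "is_unit c" by simp
      qed
      ultimately have "is_square (6 * a + 1)" using squares by blast
      from square_mod(1)[OF this] have "even a" by presburger
      then show ?thesis using n by simp
    qed
  qed
  moreover have "odd n" if "odd k"
  proof
    assume "even n"
    obtain j where "k = 2 * j + 1" using \<open>odd k\<close> by (elim oddE)
    with eq have j: "int n = (2 * j + 1) * (3 * j + 1)" by (simp add: algebra_simps)
    with \<open>even n\<close> have "even ((2 * j + 1) * (3 * j + 1))" by (metis even_of_nat_iff)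
    then have "odd j" by simp
    show False
    proof (cases j rule: int_cases2)
      case (nonneg a)
      have "int n = int ((2 * a + 1) * (3 * a + 1))"
        unfolding j nonneg by (simp add: algebra_simps)
      then have "n = (2 * a + 1) * (3 * a + 1)" by (simp only: of_nat_eq_iff)
      moreover have "coprime (2 * a + 1) (3 * a + 1)"
      proof (rule coprimeI)
        fix c assume "c dvd 2 * a + 1" "c dvd 3 * a + 1"
        then have "c dvd 3 * (2 * a + 1) - 2 * (3 * a + 1)" by (intro dvd_diff_nat dvd_mult)
        then show "is_unit c" by simp
      qed
      ultimately have "is_square (2 * a + 1)" "is_square (3 * a + 1)" using squares by blast+
      note residues = this[THEN square_mod(1)]
      have "odd a" using \<open>odd j\<close> nonneg by simp
      with residues show False by presburger
    next
      case (nonpos a)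
      with \<open>odd j\<close> obtain b where a: "a = Suc b" by (cases a) auto
      have "int n = int ((2 * b + 1) * (3 * b + 2))"
        unfolding j nonpos a by (simp add: algebra_simps)
      then have "n = (2 * b + 1) * (3 * b + 2)" by (simp only: of_nat_eq_iff)
      moreover have "coprime (2 * b + 1) (3 * b + 2)"
      proof (rule coprimeI)
        fix c assume "c dvd 2 * b + 1" "c dvd 3 * b + 2"
        then have "c dvd 2 * (3 * b + 2) - 3 * (2 * b + 1)" by (intro dvd_diff_nat dvd_mult)
        then show "is_unit c" by simp
      qed
      ultimately have "is_square (3 * b + 2)" using squares by blast
      from square_mod(2)[OF this] show False by presburger
    qed
  qed
  ultimately show ?thesis by blast
qed

section \<open>Signed counts by the parity of the smallest part\<close>

theorem corollary1p2:
  fixes n :: nat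
  assumes "n > 0"
  shows
    "(int (D_plus_odd n) - int (D_minus_odd n) =
       (if \<not> is_square n then 0
        else if even n then 1
        else -1)) \<and>
     (int (D_plus_even n) - int (D_minus_even n) =
       (if is_square n \<and> even n \<and> \<not> is_pentagonal n then -1
        else if is_square n \<and> odd n \<and> \<not> is_pentagonal n then 1
        else if is_even_index_pentagonal n \<and> \<not> is_square n then 1
        else if is_odd_index_pentagonal n \<and> \<not> is_square n then -1
        else 0))"
proof -
  let ?A = "distinct_partitions n"
  define od ev where "od = int (D_plus_odd n) - int (D_minus_odd n)"
    and "ev = int (D_plus_even n) - int (D_minus_even n)"
  have od: "od = (\<Sum>xs\<in>{xs\<in>?A. odd (smallest_part xs)}. (-1) ^ length xs)"
    unfolding od_def D_plus_odd_def D_minus_odd_def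
    by (rule card_even_minus_card_odd[OF finite_distinct_partitions])
  have ev: "ev = (\<Sum>xs\<in>{xs\<in>?A. even (smallest_part xs)}. (-1) ^ length xs)"
    unfolding ev_def D_plus_even_def D_minus_even_def
    by (rule card_even_minus_card_odd[OF finite_distinct_partitions])
  have split: "(\<Sum>xs\<in>?A. f xs) = (\<Sum>xs\<in>{xs\<in>?A. even (smallest_part xs)}. f xs)
     + (\<Sum>xs\<in>{xs\<in>?A. odd (smallest_part xs)}. f xs)" for f :: "nat list \<Rightarrow> int"
    by (subst sum.union_disjoint[symmetric])
       (auto simp: finite_distinct_partitions intro!: sum.cong)
  have "ev + od = fps_nth (qfac fps_X 0 n) n"
    unfolding sum_sign_distinct_partitions[symmetric] split od ev ..
  moreover have "ev - od = fps_nth (qfac fps_X 0 n) n - fps_nth (qexp fps_X n (- fps_X)) n"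
  proof -
    have "ev - od = (\<Sum>xs\<in>?A. (-1) ^ (smallest_part xs + length xs))"
      unfolding split od ev by (simp add: power_add sum_negf)
    then show ?thesis
      using sum_sign_smallest_distinct_partitions[OF assms] by simp
  qed
  \<comment> \<open>Subtracting the two equations gives twice \<open>od\<close>.\<close>
  ultimately have od': "od = (if \<not> is_square n then 0 else if even n then 1 else -1)"
    and ev': "ev = fps_nth (qfac fps_X 0 n) n - od"
    using fps_nth_qexp_square[OF assms] by (auto simp: minus_one_power_iff split: if_splits)
  have "ev = (if is_square n \<and> even n \<and> \<not> is_pentagonal n then -1
        else if is_square n \<and> odd n \<and> \<not> is_pentagonal n then 1
        else if is_even_index_pentagonal n \<and> \<not> is_square n then 1
        else if is_odd_index_pentagonal n \<and> \<not> is_square n then -1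
        else 0)"
  proof (cases "is_pentagonal n")
    case True
    then obtain k where k: "int n = pentagonal k" by (auto simp: is_pentagonal_def)
    then have "is_even_index_pentagonal n \<longleftrightarrow> even k" "is_odd_index_pentagonal n \<longleftrightarrow> odd k"
      using inj_pentagonal by (auto simp: is_even_index_pentagonal_def is_odd_index_pentagonal_def dest: injD)
    then show ?thesis
      using True fps_nth_qfac_pentagonal(1)[OF assms k] pentagonal_square_parity[OF assms k]
      unfolding ev' od' by auto
  next
    case False
    then have "\<not> is_even_index_pentagonal n" "\<not> is_odd_index_pentagonal n"
      by (auto simp: is_pentagonal_def is_even_index_pentagonal_def is_odd_index_pentagonal_def)
    then show ?thesis
      using False fps_nth_qfac_pentagonal(2)[OF assms] unfolding ev' od' by auto
  qed
  with od' show ?thesis unfolding od_def ev_def by blast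
qed

end
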